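(* Let $n$ be a positive integer, let $f:(0,\infty)\to\mathbb{R}$ be a positive-valued function such that $x\mapsto xf(x)$ is decreasing and differentiable, and let $A>0$ and masses $m_1,\dots,m_n>0$ be fixed. Then for every order of the masses there exists at most one equivalence class of polygonal relative equilibria, with rotation constant $A$ and center of mass $Q_M=0$, of the system $$\ddot q_i=\sum_{j=1,\ j\neq i}^{n} m_j(q_j-q_i)\,f(\|q_j-q_i\|),\qquad i\in\{1,\dots,n\},\quad q_i\in\mathbb{R}^2 .$$ That is: if $(q_1,\dots,q_n)$ and $(q_1',\dots,q_n')$ are two polygonal relative equilibria of this system with the same masses $m_1,\dots,m_n$, the same $A$, both with center of mass $0$, and both having the same order of the masses on their circles, then they are equivalent under a rotation.
   Context: $\|\cdot\|$ is the Euclidean norm on $\mathbb{R}^2$ and $T(t)=\begin{pmatrix}\cos t&-\sin t\\ \sin t&\cos t\end{pmatrix}$. A relative equilibrium (with rotation constant $A>0$) is a solution of the system of the form $q_i(t)=T(At)(Q_i-Q_M)+Q_M$, $i\in\{1,\dots,n\}$, where $Q_1,\dots,Q_n\in\mathbb{R}^2$ are constant and $Q_M=\frac1M\sum_{k=1}^n m_kQ_k$, $M=\sum_{k=1}^n m_k$, is the center of mass. A relative equilibrium is called polygonal if all the $q_i$ lie on a circle (of positive radius) with the origin at its center. The points are pairwise distinct (no collisions). Order of the masses: given a permutation $\tau$ of $\{1,\dots,n\}$, a polygonal relative equilibrium with $Q_M=0$ has the masses in the order $\tau$ if, after a rotation, $Q_{\tau(k)}=r(\cos\alpha_k,\sin\alpha_k)^T$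 for $k=1,\dots,n$ with $r>0$ and $0\le\alpha_1<\alpha_2<\dots<\alpha_n<2\pi$ (i.e. $\tau$ records the order in which the labelled masses are met going counterclockwise around the circle). Equivalence: two relative equilibria $(q_i)$ and $(q_i')$ are equivalent (in the same equivalence class) if there is a constant $c\in\mathbb{R}$ with $q_i'=T(c)q_i$ for all $i$. Scalings are not included in the equivalence. *)

theory Defs
  imports "HOL-Analysis.Analysis" "HOL-Combinatorics.Permutations"
begin

definition rot :: "real \<Rightarrow> real^2^2" where
  "rot t = vector [vector [cos t, - sin t], vector [sin t, cos t]]"

text \<open>Bodies are labelled by \<open>{1..n}\<close>; values of families at other indices are irrelevant,
  and so are the values of \<open>f\<close> outside \<open>{0<..}\<close>, since solutions are collision-free.
  Solutions are defined for all times; \<open>v i\<close> is the velocity of body \<open>i\<close>.\<close>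

definition nbody_solution ::
    "nat \<Rightarrow> (nat \<Rightarrow> real) \<Rightarrow> (real \<Rightarrow> real) \<Rightarrow> (nat \<Rightarrow> real \<Rightarrow> real^2) \<Rightarrow> bool" where
  "nbody_solution n m f q \<longleftrightarrow>
     (\<forall>t. \<forall>i\<in>{1..n}. \<forall>j\<in>{1..n}. i \<noteq> j \<longrightarrow> q i t \<noteq> q j t) \<and>
     (\<exists>v. \<forall>i\<in>{1..n}. \<forall>t.
        (q i has_vector_derivative v i t) (at t) \<and>
        (v i has_vector_derivative
           (\<Sum>j\<in>{1..n} - {i}. (m j * f (norm (q j t - q i t))) *\<^sub>R (q j t - q i t))) (at t))"

definition center_of_mass :: "nat \<Rightarrow> (nat \<Rightarrow> real) \<Rightarrow> (nat \<Rightarrow> real^2) \<Rightarrow> real^2" where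
  "center_of_mass n m Q = (1 / (\<Sum>k=1..n. m k)) *\<^sub>R (\<Sum>k=1..n. m k *\<^sub>R Q k)"

definition relative_equilibrium ::
    "nat \<Rightarrow> (nat \<Rightarrow> real) \<Rightarrow> (real \<Rightarrow> real) \<Rightarrow> real \<Rightarrow> (nat \<Rightarrow> real^2) \<Rightarrow>
     (nat \<Rightarrow> real \<Rightarrow> real^2) \<Rightarrow> bool" where
  "relative_equilibrium n m f A Q q \<longleftrightarrow>
     nbody_solution n m f q \<and>
     (\<forall>i\<in>{1..n}. \<forall>t. q i t =
        rot (A * t) *v (Q i - center_of_mass n m Q) + center_of_mass n m Q)"

definition polygonal :: "nat \<Rightarrow> (nat \<Rightarrow> real \<Rightarrow> real^2) \<Rightarrow> bool" where
  "polygonal n q \<longleftrightarrow> (\<exists>r>0. \<forall>i\<in>{1..n}. \<forall>t. norm (q i t) = r)"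

text \<open>\<open>\<tau> k\<close> is the label of the \<open>k\<close>-th mass met going counterclockwise around the circle;
  because of the rotation by \<open>c\<close>, the starting point on the circle is arbitrary.\<close>

definition masses_in_order :: "nat \<Rightarrow> (nat \<Rightarrow> nat) \<Rightarrow> (nat \<Rightarrow> real^2) \<Rightarrow> bool" where
  "masses_in_order n \<tau> Q \<longleftrightarrow>
     (\<exists>c r \<alpha>. r > 0 \<and> strict_mono_on {1..n} \<alpha> \<and>
        (\<forall>k\<in>{1..n}. 0 \<le> \<alpha> k \<and> \<alpha> k < 2 * pi \<and>
           rot c *v Q (\<tau> k) = r *\<^sub>R vector [cos (\<alpha> k), sin (\<alpha> k)]))"

definition rotation_equivalent ::
    "nat \<Rightarrow> (nat \<Rightarrow> real \<Rightarrow> real^2) \<Rightarrow> (nat \<Rightarrow> real \<Rightarrow> real^2) \<Rightarrow> bool" where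
  "rotation_equivalent n q q' \<longleftrightarrow> (\<exists>c. \<forall>i\<in>{1..n}. \<forall>t. q' i t = rot c *v q i t)"

end

theory Submission
  imports Defs
begin

text \<open>Write the configuration as $r e^{i\beta_k}$, let $s_{jk} = |\sin((\beta_k-\beta_j)/2)|$ be half
  the distances divided by the radius, and let $G_{jk} = g(2 r s_{jk})$ with $g(x) = x f(x)$. The
  radial equations give $\sum m_j m_k G_{jk} s_{jk} = K r$ with $K = A^2 \sum m_k$. The tangential
  equations together with the concavity of $\sin$ on $[0,\pi]$ give
  $\sum m_j m_k G_{jk} s'_{jk} \le K r$ for every other configuration in the same order, with
  equality only for the same angle differences. Since $g$ is decreasing,
  $\sum m_j m_k (G_{jk} - G'_{jk})(r s_{jk} - r' s'_{jk}) \le 0$. Expanding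
  yields $K (r - r')^2 \le 0$, so $r = r'$ and all the inequalities are equalities.\<close>

section \<open>Rotations of the plane\<close>

definition polar :: "real \<Rightarrow> real^2" where
  "polar b = vector [cos b, sin b]"

lemma polar_nth [simp]: "polar b $ 1 = cos b" "polar b $ 2 = sin b"
  by (simp_all add: polar_def)

lemma rot_mult_nth [simp]:
  "(rot c *v x) $ 1 = cos c * x $ 1 - sin c * x $ 2"
  "(rot c *v x) $ 2 = sin c * x $ 1 + cos c * x $ 2"
  by (simp_all add: rot_def matrix_vector_mult_def sum_2)

lemma rot_zero [simp]: "rot 0 *v x = x"
  by (simp add: vec_eq_iff forall_2)

lemma rot_pi [simp]: "rot pi *v x = - x"
  by (simp add: vec_eq_iff forall_2)

lemma rot_rot: "rot a *v (rot b *v x) = rot (a + b) *v x"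
  by (simp add: vec_eq_iff forall_2 cos_add sin_add algebra_simps)

lemma rot_polar: "rot c *v (r *\<^sub>R polar b) = r *\<^sub>R polar (b + c)"
  by (simp add: vec_eq_iff forall_2 cos_add sin_add algebra_simps)

text \<open>The law of cosines combined with 1 - cos x = 2 sin^2(x/2), applied to squares because
  both sides are nonnegative.\<close>

lemma norm_polar_diff:
  assumes "r \<ge> 0"
  shows "norm (r *\<^sub>R polar a - r *\<^sub>R polar b) = 2 * r * \<bar>sin ((a - b) / 2)\<bar>"
proof -
  have "(norm (r *\<^sub>R polar a - r *\<^sub>R polar b))\<^sup>2 = r\<^sup>2 * (2 - 2 * cos (a - b))"
    unfolding power2_norm_eq_inner
    by (simp add: inner_vec_def sum_2 cos_diff algebra_simps power2_eq_square)
      (use sin_cos_squared_add[of a] sin_cos_squared_add[of b] in algebra)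
  also have "\<dots> = (2 * r * \<bar>sin ((a - b) / 2)\<bar>)\<^sup>2"
    using cos_double_sin[of "(a - b) / 2"] by (simp add: power_mult_distrib diff_divide_distrib)
  finally show ?thesis
    using assms by (simp add: power2_eq_iff_nonneg)
qed

text \<open>Differentiating a rotation amounts to a quarter turn. Keeping the phase \<open>c\<close>
  free makes the rule apply again to its own result, which gives second derivatives.\<close>

lemma has_vector_derivative_rot:
  "((\<lambda>t. rot (A * t + c) *v x) has_vector_derivative A *\<^sub>R (rot (A * t + c + pi / 2) *v x)) (at t)"
proof -
  have rot_basis: "rot b *v x = cos b *\<^sub>R x + sin b *\<^sub>R (rot (pi / 2) *v x)" for b
    by (simp add: vec_eq_iff forall_2)
  show ?thesis
    unfolding rot_basis[of "A * _ + c"]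
    by (rule derivative_eq_intros refl)+
      (simp add: vec_eq_iff forall_2 cos_add sin_add algebra_simps)
qed

section \<open>Equations of polygonal relative equilibria\<close>

text \<open>In uniform rotation about the origin the acceleration is centripetal; at time 0 the
  equation of motion becomes a condition on the constant configuration \<open>Q\<close>.\<close>

lemma relative_equilibrium_balance:
  assumes eq: "relative_equilibrium n m f A Q q" and com: "center_of_mass n m Q = 0"
    and i: "i \<in> {1..n}"
  shows "(\<Sum>j\<in>{1..n} - {i}. (m j * f (norm (Q j - Q i))) *\<^sub>R (Q j - Q i)) = - A\<^sup>2 *\<^sub>R Q i"
proof -
  have q: "q j t = rot (A * t) *v Q j" if "j \<in> {1..n}" for j t
    using eq com that by (simp add: relative_equilibrium_def)
  obtain v where v: "\<And>t. (q i has_vector_derivative v t) (at t)"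
    and v': "\<And>t. (v has_vector_derivative
      (\<Sum>j\<in>{1..n} - {i}. (m j * f (norm (q j t - q i t))) *\<^sub>R (q j t - q i t))) (at t)"
    using eq i unfolding relative_equilibrium_def nbody_solution_def by blast
  have "q i = (\<lambda>t. rot (A * t + 0) *v Q i)"
    by (simp add: q[OF i] fun_eq_iff)
  then have "(q i has_vector_derivative A *\<^sub>R (rot (A * t + 0 + pi / 2) *v Q i)) (at t)" for t
    using has_vector_derivative_rot by metis
  then have "v t = A *\<^sub>R (rot (A * t + 0 + pi / 2) *v Q i)" for t
    using vector_derivative_unique_at v by blast
  then have "v = (\<lambda>t. A *\<^sub>R (rot (A * t + pi / 2) *v Q i))"
    by (simp add: fun_eq_iff)
  \<comment> \<open>Two quarter turns make a half turn, \<open>rot pi\<close>, which is the source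
    of the minus sign in the claim.\<close>
  then have "(v has_vector_derivative A *\<^sub>R (A *\<^sub>R (rot (A * 0 + pi / 2 + pi / 2) *v Q i))) (at 0)"
    using bounded_linear.has_vector_derivative
      [OF bounded_linear_scaleR_right has_vector_derivative_rot[of A "pi / 2" "Q i" 0]]
    by simp
  with v'[of 0] have "(\<Sum>j\<in>{1..n} - {i}. (m j * f (norm (q j 0 - q i 0))) *\<^sub>R (q j 0 - q i 0))
      = A *\<^sub>R (A *\<^sub>R (rot (A * 0 + pi / 2 + pi / 2) *v Q i))"
    by (rule vector_derivative_unique_at)
  moreover have "(\<Sum>j\<in>{1..n} - {i}. (m j * f (norm (q j 0 - q i 0))) *\<^sub>R (q j 0 - q i 0))
      = (\<Sum>j\<in>{1..n} - {i}. (m j * f (norm (Q j - Q i))) *\<^sub>R (Q j - Q i))"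
    using i by (intro sum.cong) (auto simp: q)
  ultimately show ?thesis
    by (simp add: power2_eq_square)
qed

text \<open>Only differences are constrained, so the rotation in \<open>masses_in_order\<close> can
  be absorbed into the angles. Half of each difference lies in (0, pi), where sin is positive and
  strictly concave.\<close>

definition cyclically_ordered :: "nat \<Rightarrow> (nat \<Rightarrow> real) \<Rightarrow> bool" where
  "cyclically_ordered n b \<longleftrightarrow>
     (\<forall>j\<in>{1..n}. \<forall>k\<in>{1..n}. j < k \<longrightarrow> 0 < b k - b j \<and> b k - b j < 2 * pi)"

definition chord :: "(nat \<Rightarrow> real) \<Rightarrow> nat \<Rightarrow> nat \<Rightarrow> real" where
  "chord b j k = \<bar>sin ((b k - b j) / 2)\<bar>"

text \<open>The first equation is the radial, the second one the tangential component of the force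
  balance. The terms with \<open>j = k\<close> vanish, whatever the value of \<open>f 0\<close>.\<close>

definition circular_equilibrium ::
    "nat \<Rightarrow> (nat \<Rightarrow> real) \<Rightarrow> (real \<Rightarrow> real) \<Rightarrow> real \<Rightarrow> real \<Rightarrow> (nat \<Rightarrow> real) \<Rightarrow> bool" where
  "circular_equilibrium n \<mu> f A r b \<longleftrightarrow>
     (\<forall>k\<in>{1..n}.
        (\<Sum>j=1..n. \<mu> j * f (2 * r * chord b j k) * (2 * r * (chord b j k)\<^sup>2)) = A\<^sup>2 * r \<and>
        (\<Sum>j=1..n. \<mu> j * f (2 * r * chord b j k) * sin (b k - b j)) = 0)"

lemma masses_in_orderE:
  assumes "masses_in_order n \<tau> Q"
  obtains r b where "r > 0" "cyclically_ordered n b"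
    "\<And>k. k \<in> {1..n} \<Longrightarrow> Q (\<tau> k) = r *\<^sub>R polar (b k)"
proof -
  obtain c r a where r: "r > 0" and mono: "strict_mono_on {1..n} a"
    and bounds: "\<And>k. k \<in> {1..n} \<Longrightarrow> 0 \<le> a k \<and> a k < 2 * pi"
    and Q: "\<And>k. k \<in> {1..n} \<Longrightarrow> rot c *v Q (\<tau> k) = r *\<^sub>R polar (a k)"
    using assms unfolding masses_in_order_def polar_def by blast
  show ?thesis
  proof
    show "cyclically_ordered n (\<lambda>k. a k - c)"
      unfolding cyclically_ordered_def
    proof (intro ballI impI)
      fix j k assume "j \<in> {1..n}" "k \<in> {1..n}" "j < k"
      then show "0 < a k - c - (a j - c) \<and> a k - c - (a j - c) < 2 * pi"
        using strict_mono_onD[OF mono, of j k] bounds[of j] bounds[of k] by simp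
    qed
    show "Q (\<tau> k) = r *\<^sub>R polar (a k - c)" if "k \<in> {1..n}" for k
      using arg_cong[OF Q[OF that], of "\<lambda>x. rot (- c) *v x"] by (simp add: rot_rot rot_polar)
  qed fact
qed

text \<open>After relabelling by \<open>\<tau>\<close>, the vector balance at body \<open>k\<close>
  is projected onto the radial direction \<open>polar (b k)\<close> and the tangential direction
  \<open>polar (b k + pi / 2)\<close>.\<close>

lemma circular_equilibrium_of_relative_equilibrium:
  assumes eq: "relative_equilibrium n m f A Q q" and com: "center_of_mass n m Q = 0"
    and \<tau>: "\<tau> permutes {1..n}" and r: "r > 0"
    and Q: "\<And>k. k \<in> {1..n} \<Longrightarrow> Q (\<tau> k) = r *\<^sub>R polar (b k)"
  shows "circular_equilibrium n (m \<circ> \<tau>) f A r b"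
  unfolding circular_equilibrium_def
proof
  fix k assume k: "k \<in> {1..n}"
  let ?F = "\<lambda>j. m (\<tau> j) * f (2 * r * chord b j k)"
  have \<tau>k: "\<tau> k \<in> {1..n}"
    using permutes_in_image[OF \<tau>] k by blast
  have chord: "norm (Q (\<tau> j) - Q (\<tau> k)) = 2 * r * chord b j k" if "j \<in> {1..n}" for j
  proof -
    have "norm (Q (\<tau> j) - Q (\<tau> k)) = norm (r *\<^sub>R polar (b k) - r *\<^sub>R polar (b j))"
      using Q[OF that] Q[OF k] by (simp add: norm_minus_commute)
    then show ?thesis
      using r by (simp add: norm_polar_diff chord_def)
  qed
  \<comment> \<open>The term of the body itself is the zero vector; including it makes the index set
    invariant under \<open>\<tau>\<close>.\<close>
  have "- A\<^sup>2 *\<^sub>R Q (\<tau> k)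
      = (\<Sum>j=1..n. (m j * f (norm (Q j - Q (\<tau> k)))) *\<^sub>R (Q j - Q (\<tau> k)))"
    using relative_equilibrium_balance[OF eq com \<tau>k]
      sum.remove[of "{1..n}" "\<tau> k" "\<lambda>j. (m j * f (norm (Q j - Q (\<tau> k)))) *\<^sub>R (Q j - Q (\<tau> k))"] \<tau>k
    by simp
  also have "\<dots> = (\<Sum>j=1..n. (m (\<tau> j) * f (norm (Q (\<tau> j) - Q (\<tau> k)))) *\<^sub>R (Q (\<tau> j) - Q (\<tau> k)))"
    using sum.permute[OF \<tau>, of "\<lambda>j. (m j * f (norm (Q j - Q (\<tau> k)))) *\<^sub>R (Q j - Q (\<tau> k))"]
    by (simp add: o_def)
  also have "\<dots> = (\<Sum>j=1..n. ?F j *\<^sub>R (r *\<^sub>R polar (b j) - r *\<^sub>R polar (b k)))"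
    using k by (intro sum.cong refl) (simp only: chord, simp add: Q)
  finally have balance: "- A\<^sup>2 *\<^sub>R (r *\<^sub>R polar (b k))
      = (\<Sum>j=1..n. ?F j *\<^sub>R (r *\<^sub>R polar (b j) - r *\<^sub>R polar (b k)))"
    using Q[OF k] by simp
  have inner_polar: "polar x \<bullet> polar y = cos (x - y)" for x y
    by (simp add: inner_vec_def sum_2 cos_diff)
  \<comment> \<open>The direction \<open>y\<close> stays free so that one computation serves both
    projections.\<close>
  have inner_balance: "- A\<^sup>2 * (r * cos (b k - y))
      = (\<Sum>j=1..n. ?F j * (r * cos (b j - y) - r * cos (b k - y)))" for y
    using arg_cong[OF balance, of "\<lambda>x. x \<bullet> polar y"]
    by (simp add: inner_sum_left inner_diff_left inner_polar)
  have "A\<^sup>2 * r = - (\<Sum>j=1..n. ?F j * (r * cos (b j - b k) - r))"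
    using inner_balance[of "b k"] by simp
  also have "\<dots> = (\<Sum>j=1..n. ?F j * (2 * r * (chord b j k)\<^sup>2))"
    unfolding sum_negf[symmetric]
  proof (intro sum.cong refl)
    fix j
    have "cos (b j - b k) = 1 - 2 * (chord b j k)\<^sup>2"
      using cos_double_sin[of "(b k - b j) / 2"] cos_minus[of "b k - b j"]
      by (simp add: chord_def diff_divide_distrib)
    then show "- (?F j * (r * cos (b j - b k) - r)) = ?F j * (2 * r * (chord b j k)\<^sup>2)"
      by (simp only:) (simp add: algebra_simps)
  qed
  finally have radial: "(\<Sum>j=1..n. ?F j * (2 * r * (chord b j k)\<^sup>2)) = A\<^sup>2 * r" ..
  have cos_shift: "cos (b j - (b k + pi / 2)) = - sin (b k - b j)" for j
    by (simp add: cos_diff sin_diff cos_add sin_add)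
  have "0 = (\<Sum>j=1..n. ?F j * (r * - sin (b k - b j)))"
    using inner_balance[of "b k + pi / 2"] cos_shift[of k] by (simp add: cos_shift)
  also have "\<dots> = - r * (\<Sum>j=1..n. ?F j * sin (b k - b j))"
    unfolding sum_distrib_left by (intro sum.cong) simp_all
  finally have "(\<Sum>j=1..n. ?F j * sin (b k - b j)) = 0"
    using r by simp
  with radial show "(\<Sum>j=1..n. (m \<circ> \<tau>) j * f (2 * r * chord b j k) * (2 * r * (chord b j k)\<^sup>2)) = A\<^sup>2 * r \<and>
      (\<Sum>j=1..n. (m \<circ> \<tau>) j * f (2 * r * chord b j k) * sin (b k - b j)) = 0"
    by simp
qed

section \<open>Comparing two configurations in the same order\<close>

text \<open>Strict concavity of sin: by the mean value theorem the secant slope is a value of cos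
  strictly between \<open>x\<close> and \<open>y\<close>, and cos is strictly decreasing on
  [0, pi].\<close>

lemma sin_less_tangent:
  assumes "0 \<le> x" "x \<le> pi" "0 \<le> y" "y \<le> pi" "x \<noteq> y"
  shows "sin y < sin x + cos x * (y - x)"
proof (cases "x < y")
  case True
  then obtain z where z: "x < z" "z < y" "sin y - sin x = (y - x) * cos z"
    using MVT2[of x y sin cos] DERIV_sin by blast
  have "cos z < cos x"
    using z assms by (intro cos_monotone_0_pi) auto
  then show ?thesis
    using z True mult_strict_left_mono[of "cos z" "cos x" "y - x"] by (simp add: algebra_simps)
next
  case False
  then have "y < x"
    using assms by simp
  then obtain z where z: "y < z" "z < x" "sin x - sin y = (x - y) * cos z"
    using MVT2[of y x sin cos] DERIV_sin by blast
  have "cos x < cos z"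
    using z assms by (intro cos_monotone_0_pi) auto
  then show ?thesis
    using z \<open>y < x\<close> mult_strict_left_mono[of "cos x" "cos z" "x - y"] by (simp add: algebra_simps)
qed

section \<open>Chords of cyclically ordered angles\<close>

lemma chord_commute: "chord b j k = chord b k j"
  using sin_minus[of "(b k - b j) / 2"] unfolding chord_def by (simp add: minus_divide_left)

lemma chord_self [simp]: "chord b k k = 0"
  by (simp add: chord_def)

lemma chord_pos:
  assumes "cyclically_ordered n b" "j \<in> {1..n}" "k \<in> {1..n}" "j \<noteq> k"
  shows "chord b j k > 0"
proof -
  have *: "chord b j k > 0" if "j \<in> {1..n}" "k \<in> {1..n}" "j < k" for j k
    using assms(1) that sin_gt_zero[of "(b k - b j) / 2"]
    unfolding cyclically_ordered_def chord_def by force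
  show ?thesis
    using *[of j k] *[of k j] assms(2-4) by (cases "j < k") (auto simp: chord_commute[of b j k])
qed

text \<open>The tangent inequality at the half differences, multiplied by the sine of the first one.
  The factor turns the slope cos into the sine of the full difference, the quantity in the
  tangential equation; 1/4 comes from the double angle formula and the halving. Both sides are
  symmetric in \<open>j\<close> and \<open>k\<close>, so \<open>j < k\<close> suffices.\<close>

lemma chord_mult_less_tangent:
  assumes "cyclically_ordered n b" "cyclically_ordered n b'"
    and "j \<in> {1..n}" "k \<in> {1..n}" "b' k - b' j \<noteq> b k - b j"
  shows "chord b j k * chord b' j k
    < (chord b j k)\<^sup>2 + sin (b k - b j) * ((b' k - b' j) - (b k - b j)) / 4"
proof -
  have *: "chord b j k * chord b' j k
      < (chord b j k)\<^sup>2 + sin (b k - b j) * ((b' k - b' j) - (b k - b j)) / 4"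
    if jk: "j \<in> {1..n}" "k \<in> {1..n}" "j < k" and ne: "b' k - b' j \<noteq> b k - b j" for j k
  proof -
    define x y where "x = (b k - b j) / 2" and "y = (b' k - b' j) / 2"
    have diff: "b k - b j = 2 * x" "b' k - b' j = 2 * y"
      by (simp_all add: x_def y_def)
    have xy: "0 < x" "x < pi" "0 < y" "y < pi" "x \<noteq> y"
      using assms(1,2) jk ne unfolding cyclically_ordered_def x_def y_def by force+
    then have pos: "sin x > 0" "sin y > 0"
      by (simp_all add: sin_gt_zero)
    have "sin x * sin y < sin x * (sin x + cos x * (y - x))"
      using sin_less_tangent[of x y] xy pos by (intro mult_strict_left_mono) auto
    also have "\<dots> = (sin x)\<^sup>2 + sin (2 * x) * (2 * y - 2 * x) / 4"
      unfolding sin_double by (simp add: field_simps power2_eq_square)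
    finally show ?thesis
      using pos by (simp add: chord_def diff)
  qed
  have "j \<noteq> k"
    using assms(5) by auto
  have sin_commute: "sin (b j - b k) = - sin (b k - b j)"
    using sin_minus[of "b k - b j"] by simp
  show ?thesis
  proof (cases "j < k")
    case True
    then show ?thesis using *[of j k] assms by simp
  next
    case False
    then have "chord b k j * chord b' k j
      < (chord b k j)\<^sup>2 + sin (b j - b k) * ((b' j - b' k) - (b j - b k)) / 4"
      using \<open>j \<noteq> k\<close> assms by (intro *) auto
    moreover have "sin (b j - b k) * ((b' j - b' k) - (b j - b k))
        = sin (b k - b j) * ((b' k - b' j) - (b k - b j))"
      unfolding sin_commute by (simp add: algebra_simps)
    ultimately show ?thesis
      by (simp add: chord_commute[of _ j k])
  qed
qed

text \<open>The decreasing function x f(x) at the distance between the two bodies: the strength of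
  their attraction apart from the masses.\<close>

definition force :: "(real \<Rightarrow> real) \<Rightarrow> real \<Rightarrow> (nat \<Rightarrow> real) \<Rightarrow> nat \<Rightarrow> nat \<Rightarrow> real" where
  "force f r b j k = 2 * r * chord b j k * f (2 * r * chord b j k)"

lemma circular_equilibrium_radial_sum:
  assumes "circular_equilibrium n \<mu> f A r b"
  shows "(\<Sum>k=1..n. \<Sum>j=1..n. \<mu> j * \<mu> k * (force f r b j k * chord b j k))
    = A\<^sup>2 * (\<Sum>k=1..n. \<mu> k) * r"
proof -
  have "(\<Sum>j=1..n. \<mu> j * \<mu> k * (force f r b j k * chord b j k)) = \<mu> k * (A\<^sup>2 * r)"
    if "k \<in> {1..n}" for k
  proof -
    have "(\<Sum>j=1..n. \<mu> j * \<mu> k * (force f r b j k * chord b j k))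
        = \<mu> k * (\<Sum>j=1..n. \<mu> j * f (2 * r * chord b j k) * (2 * r * (chord b j k)\<^sup>2))"
      unfolding sum_distrib_left
      by (intro sum.cong) (simp_all add: force_def power2_eq_square)
    then show ?thesis
      using assms that by (simp add: circular_equilibrium_def)
  qed
  then show ?thesis
    by (simp add: sum_distrib_right sum_distrib_left mult_ac)
qed

text \<open>A virtual work identity: the tangential forces do no work under any angular
  displacements \<open>x\<close>. The part with \<open>x k\<close> vanishes body by body, and the
  part with \<open>x j\<close> reduces to it by antisymmetry of the pair forces.\<close>

lemma circular_equilibrium_tangential_sum:
  assumes "circular_equilibrium n \<mu> f A r b"
  shows "(\<Sum>k=1..n. \<Sum>j=1..n. \<mu> j * \<mu> k * f (2 * r * chord b j k) * sin (b k - b j) * (x k - x j)) = 0"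
proof -
  let ?T = "\<lambda>j k. \<mu> j * f (2 * r * chord b j k) * sin (b k - b j)"
  have tangential: "(\<Sum>j=1..n. ?T j k) = 0" if "k \<in> {1..n}" for k
    using assms that by (simp add: circular_equilibrium_def)
  have T_commute: "\<mu> k * ?T j k = - (\<mu> j * ?T k j)" for j k
    using sin_minus[of "b k - b j"] by (simp add: chord_commute[of b j k])
  have "(\<Sum>k=1..n. \<Sum>j=1..n. \<mu> k * ?T j k * x k) = (\<Sum>k=1..n. \<mu> k * x k * (\<Sum>j=1..n. ?T j k))"
    unfolding sum_distrib_left by (intro sum.cong) simp_all
  also have "\<dots> = 0"
    by (intro sum.neutral ballI) (simp only: tangential mult_zero_right)
  finally have 1: "(\<Sum>k=1..n. \<Sum>j=1..n. \<mu> k * ?T j k * x k) = 0" .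
  have "(\<Sum>k=1..n. \<Sum>j=1..n. \<mu> k * ?T j k * x j) = (\<Sum>j=1..n. \<Sum>k=1..n. \<mu> k * ?T j k * x j)"
    by (rule sum.swap)
  also have "\<dots> = (\<Sum>j=1..n. \<Sum>k=1..n. - (\<mu> j * ?T k j * x j))"
    by (intro sum.cong refl, subst T_commute) (rule mult_minus_left)
  also have "\<dots> = - (\<Sum>j=1..n. \<Sum>k=1..n. \<mu> j * ?T k j * x j)"
    by (simp add: sum_negf)
  finally have 2: "(\<Sum>k=1..n. \<Sum>j=1..n. \<mu> k * ?T j k * x j) = 0"
    using 1 by simp
  have "(\<Sum>k=1..n. \<Sum>j=1..n. \<mu> j * \<mu> k * f (2 * r * chord b j k) * sin (b k - b j) * (x k - x j))
      = (\<Sum>k=1..n. \<Sum>j=1..n. \<mu> k * ?T j k * x k) - (\<Sum>k=1..n. \<Sum>j=1..n. \<mu> k * ?T j k * x j)"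
    unfolding sum_subtractf[symmetric] by (intro sum.cong) (simp_all add: algebra_simps)
  then show ?thesis
    using 1 2 by simp
qed

text \<open>The tangent inequality is summed over all pairs with weights
  \<open>\<mu> j * \<mu> k * (2 * r * f (2 * r * chord b j k))\<close>. The quadratic terms add up
  to the radial sum and the linear ones cancel by the virtual work identity; one changed difference
  makes the result strict.\<close>

lemma circular_equilibrium_mixed_sum:
  assumes f: "\<forall>x>0. f x > 0" and \<mu>: "\<forall>k\<in>{1..n}. \<mu> k > 0" and r: "r > 0"
    and ord: "cyclically_ordered n b" "cyclically_ordered n b'"
    and eq: "circular_equilibrium n \<mu> f A r b"
  shows "(\<Sum>k=1..n. \<Sum>j=1..n. \<mu> j * \<mu> k * (force f r b j k * chord b' j k))
      \<le> A\<^sup>2 * (\<Sum>k=1..n. \<mu> k) * r" (is "?L \<le> ?R")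
    and "\<lbrakk>j0 \<in> {1..n}; k0 \<in> {1..n}; b' k0 - b' j0 \<noteq> b k0 - b j0\<rbrakk> \<Longrightarrow>
      (\<Sum>k=1..n. \<Sum>j=1..n. \<mu> j * \<mu> k * (force f r b j k * chord b' j k))
        < A\<^sup>2 * (\<Sum>k=1..n. \<mu> k) * r"
proof -
  \<comment> \<open>The factor r/2 is 2r from \<open>force\<close> times 1/4 from the tangent
    inequality.\<close>
  define x where "x k = r / 2 * (b' k - b k)" for k
  let ?l = "\<lambda>j k. \<mu> j * \<mu> k * (force f r b j k * chord b' j k)"
  let ?u = "\<lambda>j k. \<mu> j * \<mu> k * (force f r b j k * chord b j k)
    + \<mu> j * \<mu> k * f (2 * r * chord b j k) * sin (b k - b j) * (x k - x j)"
  have less: "?l j k < ?u j k"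
    if jk: "j \<in> {1..n}" "k \<in> {1..n}" and ne: "b' k - b' j \<noteq> b k - b j" for j k
  proof -
    have "j \<noteq> k"
      using ne by auto
    then have "0 < 2 * r * chord b j k"
      using chord_pos[OF ord(1) jk] r by simp
    then have "0 < \<mu> j * \<mu> k * (2 * r * f (2 * r * chord b j k))"
      using f \<mu> jk r by simp
    from mult_strict_left_mono[OF chord_mult_less_tangent[OF ord jk ne] this]
    show ?thesis
      by (simp add: force_def x_def power2_eq_square field_simps)
  qed
  have le: "?l j k \<le> ?u j k" if jk: "j \<in> {1..n}" "k \<in> {1..n}" for j k
  proof (cases "b' k - b' j = b k - b j")
    case True
    then have "chord b' j k = chord b j k"
      by (simp add: chord_def)
    moreover have "b' k - b k = b' j - b j"
      using True by simp
    then have "x k = x j"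
      by (simp only: x_def)
    ultimately show ?thesis by simp
  qed (use less[OF jk] in simp)
  have u: "(\<Sum>k=1..n. \<Sum>j=1..n. ?u j k) = ?R"
    unfolding sum.distrib circular_equilibrium_radial_sum[OF eq]
      circular_equilibrium_tangential_sum[OF eq] by simp
  show "?L \<le> ?R"
    unfolding u[symmetric] by (intro sum_mono le)
  assume j0: "j0 \<in> {1..n}" and k0: "k0 \<in> {1..n}" and ne: "b' k0 - b' j0 \<noteq> b k0 - b j0"
  show "?L < ?R"
    unfolding u[symmetric]
  proof (rule sum_strict_mono_ex1)
    show "\<forall>k\<in>{1..n}. (\<Sum>j=1..n. ?l j k) \<le> (\<Sum>j=1..n. ?u j k)"
      by (intro ballI sum_mono le)
    show "\<exists>k\<in>{1..n}. (\<Sum>j=1..n. ?l j k) < (\<Sum>j=1..n. ?u j k)"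
    proof (rule bexI[OF _ k0], rule sum_strict_mono_ex1)
      show "\<forall>j\<in>{1..n}. ?l j k0 \<le> ?u j k0"
        using le k0 by blast
      show "\<exists>j\<in>{1..n}. ?l j k0 < ?u j k0"
        using less[OF j0 k0 ne] j0 by blast
    qed simp
  qed simp
qed

section \<open>Monotonicity of the force and uniqueness\<close>

lemma antimono_on_mult_le_zero:
  fixes g :: "real \<Rightarrow> real"
  assumes "antimono_on S g" "x \<in> S" "y \<in> S"
  shows "(g x - g y) * (x - y) \<le> 0"
  using monotone_onD[OF assms(1), of x y] monotone_onD[OF assms(1), of y x] assms(2,3)
  by (cases "x \<le> y") (auto simp: mult_le_0_iff)

text \<open>Each configuration is a competitor in the mixed inequality of the other. The radii are
  identified first, and only then are the angles compared by strictness.\<close>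

theorem circular_equilibrium_unique:
  assumes n: "n \<ge> 1" and A: "A > 0" and f: "\<forall>x>0. f x > 0"
    and anti: "antimono_on {0<..} (\<lambda>x. x * f x)"
    and \<mu>: "\<forall>k\<in>{1..n}. \<mu> k > 0" and r: "r > 0" "r' > 0"
    and ord: "cyclically_ordered n b" "cyclically_ordered n b'"
    and eq: "circular_equilibrium n \<mu> f A r b" "circular_equilibrium n \<mu> f A r' b'"
  shows "r' = r" and "\<forall>j\<in>{1..n}. \<forall>k\<in>{1..n}. b' k - b' j = b k - b j"
proof -
  define K where "K = A\<^sup>2 * (\<Sum>k=1..n. \<mu> k)"
  have "(\<Sum>k=1..n. \<mu> k) > 0"
    using n \<mu> by (intro sum_pos) auto
  then have K: "K > 0"
    using A by (simp add: K_def)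
  define S where "S G s = (\<Sum>k=1..n. \<Sum>j=1..n. \<mu> j * \<mu> k * (G j k * s j k))"
    for G s :: "nat \<Rightarrow> nat \<Rightarrow> real"
  let ?G = "force f r b" and ?G' = "force f r' b'" and ?s = "chord b" and ?s' = "chord b'"
  have rad: "S ?G ?s = K * r" "S ?G' ?s' = K * r'"
    using circular_equilibrium_radial_sum[OF eq(1)] circular_equilibrium_radial_sum[OF eq(2)]
    by (simp_all add: S_def K_def)
  have mixed: "S ?G ?s' \<le> K * r" "S ?G' ?s \<le> K * r'"
    using circular_equilibrium_mixed_sum(1)[OF f \<mu> r(1) ord eq(1)]
      circular_equilibrium_mixed_sum(1)[OF f \<mu> r(2) ord(2,1) eq(2)]
    by (simp_all add: S_def K_def)
  have "(\<Sum>k=1..n. \<Sum>j=1..n.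
      \<mu> j * \<mu> k * ((?G j k - ?G' j k) * (r * ?s j k - r' * ?s' j k))) \<le> 0"
  proof (intro sum_nonpos)
    fix j k assume kj: "k \<in> {1..n}" "j \<in> {1..n}"
    have "(?G j k - ?G' j k) * (r * ?s j k - r' * ?s' j k) \<le> 0"
    \<comment> \<open>On the diagonal both distances are 0, outside the domain of monotonicity, but
      the product is 0 as both chords vanish.\<close>
    proof (cases "j = k")
      case False
      then have "0 < 2 * r * ?s j k" "0 < 2 * r' * ?s' j k"
        using chord_pos[OF ord(1) kj(2,1)] chord_pos[OF ord(2) kj(2,1)] r by simp_all
      then have "(?G j k - ?G' j k) * (2 * r * ?s j k - 2 * r' * ?s' j k) \<le> 0"
        using antimono_on_mult_le_zero[OF anti, of "2 * r * ?s j k" "2 * r' * ?s' j k"]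
        by (simp add: force_def)
      then show ?thesis
        by (simp add: mult_le_0_iff)
    qed simp
    moreover have "\<mu> j * \<mu> k > 0"
      using \<mu> kj by simp
    ultimately show "\<mu> j * \<mu> k * ((?G j k - ?G' j k) * (r * ?s j k - r' * ?s' j k)) \<le> 0"
      by (simp add: mult_le_0_iff)
  qed
  also have "(\<Sum>k=1..n. \<Sum>j=1..n.
      \<mu> j * \<mu> k * ((?G j k - ?G' j k) * (r * ?s j k - r' * ?s' j k)))
      = r * S ?G ?s - r' * S ?G ?s' - r * S ?G' ?s + r' * S ?G' ?s'"
    unfolding S_def sum_distrib_left sum_subtractf[symmetric] sum.distrib[symmetric]
    by (intro sum.cong) (simp_all add: algebra_simps)
  finally have ineq: "r * (K * r) + r' * (K * r') \<le> r' * S ?G ?s' + r * S ?G' ?s"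
    by (simp add: rad)
  also have "\<dots> \<le> r' * (K * r) + r * (K * r')"
    using mixed r by (intro add_mono mult_left_mono) auto
  \<comment> \<open>The radial sums contribute the squares of the radii and the mixed sums at most
    the cross terms.\<close>
  finally have "K * (r' - r)\<^sup>2 \<le> 0"
    by (simp add: power2_eq_square algebra_simps)
  then have "(r' - r)\<^sup>2 \<le> 0"
    using K by (simp add: mult_le_0_iff)
  then show r'_eq: "r' = r"
    by simp
  show "\<forall>j\<in>{1..n}. \<forall>k\<in>{1..n}. b' k - b' j = b k - b j"
  proof (intro ballI, rule ccontr)
    fix j k assume "j \<in> {1..n}" "k \<in> {1..n}" "b' k - b' j \<noteq> b k - b j"
    then have "S ?G ?s' < K * r"
      using circular_equilibrium_mixed_sum(2)[OF f \<mu> r(1) ord eq(1)] by (simp add: S_def K_def)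
    \<comment> \<open>For equal radii \<open>ineq\<close> forces the two mixed sums to total at
      least 2Kr, so a single strict bound is contradictory.\<close>
    with mixed(2) have "S ?G ?s' + S ?G' ?s < 2 * K * r"
      by (simp add: r'_eq)
    then have "r * (S ?G ?s' + S ?G' ?s) < r * (2 * K * r)"
      using r by (intro mult_strict_left_mono)
    then show False
      using ineq by (simp add: r'_eq algebra_simps)
  qed
qed

theorem theorem1p1:
  fixes n :: nat and f :: "real \<Rightarrow> real" and A :: real and m :: "nat \<Rightarrow> real"
    and \<tau> :: "nat \<Rightarrow> nat"
    and Q Q' :: "nat \<Rightarrow> real^2" and q q' :: "nat \<Rightarrow> real \<Rightarrow> real^2"
  assumes "n \<ge> 1"
    and "\<forall>x>0. f x > 0"
    and "antimono_on {0<..} (\<lambda>x. x * f x)"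
    and "(\<lambda>x. x * f x) differentiable_on {0<..}"
    and "A > 0"
    and "\<forall>i\<in>{1..n}. m i > 0"
    and "\<tau> permutes {1..n}"
    and "relative_equilibrium n m f A Q q" and "polygonal n q"
    and "center_of_mass n m Q = 0" and "masses_in_order n \<tau> Q"
    and "relative_equilibrium n m f A Q' q'" and "polygonal n q'"
    and "center_of_mass n m Q' = 0" and "masses_in_order n \<tau> Q'"
  shows "rotation_equivalent n q q'"
proof -
  note eq = assms(8) and com = assms(10) and eq' = assms(12) and com' = assms(14)
  obtain r b where r: "r > 0" and ord: "cyclically_ordered n b"
    and Q: "\<And>k. k \<in> {1..n} \<Longrightarrow> Q (\<tau> k) = r *\<^sub>R polar (b k)"
    using assms(11) by (rule masses_in_orderE) (rule that)
  obtain r' b' where r': "r' > 0" and ord': "cyclically_ordered n b'"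
    and Q': "\<And>k. k \<in> {1..n} \<Longrightarrow> Q' (\<tau> k) = r' *\<^sub>R polar (b' k)"
    using assms(15) by (rule masses_in_orderE) (rule that)
  have \<mu>: "\<forall>k\<in>{1..n}. (m \<circ> \<tau>) k > 0"
    using assms(6) permutes_image[OF assms(7)] by (metis comp_apply imageI)
  have ceq: "circular_equilibrium n (m \<circ> \<tau>) f A r b"
    using eq com assms(7) r Q by (rule circular_equilibrium_of_relative_equilibrium)
  have ceq': "circular_equilibrium n (m \<circ> \<tau>) f A r' b'"
    using eq' com' assms(7) r' Q' by (rule circular_equilibrium_of_relative_equilibrium)
  note unique = circular_equilibrium_unique[OF assms(1,5,2,3) \<mu> r r' ord ord' ceq ceq']
  \<comment> \<open>All angles differ by one constant, read off at the first mass, which exists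
    since n is at least 1.\<close>
  define c where "c = b' 1 - b 1"
  have rot: "Q' i = rot c *v Q i" if "i \<in> {1..n}" for i
  proof -
    have "i \<in> \<tau> ` {1..n}"
      using that by (simp only: permutes_image[OF assms(7)])
    then obtain k where k: "k \<in> {1..n}" "i = \<tau> k"
      by blast
    have "b' k - b' 1 = b k - b 1"
      using unique(2) assms(1) k(1) by auto
    then have "b' k = b k + c"
      by (simp add: c_def)
    then show ?thesis
      using unique(1) by (simp only: k(2) Q[OF k(1)] Q'[OF k(1)] rot_polar)
  qed
  have "q' i t = rot c *v q i t" if "i \<in> {1..n}" for i t
  proof -
    have "q i t = rot (A * t) *v Q i" "q' i t = rot (A * t) *v Q' i"
      using eq com eq' com' that by (simp_all add: relative_equilibrium_def)
    then show ?thesis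
      \<comment> \<open>Plane rotations commute, so the angle \<open>c\<close> found for the
        constant positions works at every time.\<close>
      by (simp add: rot[OF that] rot_rot add.commute)
  qed
  then show ?thesis
    unfolding rotation_equivalent_def by blast
qed

end
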